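(* Let $N\ge 1$, let $(a_k)_{0\le k\le N}$ be complex numbers such that $a_0a_N\neq 0$, and let $P(Z)=\sum_{k=0}^N a_kZ^k$. Let $$L_N(P)=\log\sum_{k=0}^{N}|a_k|-\frac12\log|a_0|-\frac12\log|a_N|.$$ Then for $0<\rho<1$, $$1-\frac1N\,\nu_N(\rho)\le\frac{2}{N\rho}\,L_N(P).$$
   Context: Let $z_1,\dots,z_N$ be the complex zeros of $P$, counted with multiplicity. For $0<\rho<1$, $\nu_N(\rho)=\#\{k: 1-\rho\le |z_k|\le \frac{1}{1-\rho}\}$. *)

theory Defs
  imports "HOL-Computational_Algebra.Computational_Algebra"
begin

text \<open>
  The size of a filtered multiset counts zeros with multiplicity.
\<close>
definition nu :: "complex poly \<Rightarrow> real \<Rightarrow> nat" where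
  "nu P \<rho> = size {#z \<in># proots P. 1 - \<rho> \<le> norm z \<and> norm z \<le> 1 / (1 - \<rho>)#}"

definition L :: "nat \<Rightarrow> complex poly \<Rightarrow> real" where
  "L N P = ln (\<Sum>k\<le>N. norm (coeff P k)) - 1 / 2 * ln (norm (coeff P 0))
             - 1 / 2 * ln (norm (coeff P N))"

end

theory Submission
  imports Defs "HOL-Complex_Analysis.Conformal_Mappings"
begin

text \<open>
  \<open>L\<close> is the logarithm of the ratio of the coefficient sum \<open>S\<close> to the geometric mean of
  \<open>\<bar>a\<^sub>0\<bar>\<close> and \<open>\<bar>a\<^sub>N\<bar>\<close>. Every zero off the annulus
  \<open>1 - \<rho> \<le> \<bar>z\<bar> \<le> 1 / (1 - \<rho>)\<close> adds at least \<open>\<rho>\<close> to a lower bound for \<open>2 L\<close>.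

  Write \<open>P(z) = c \<Prod>(z - x)\<close>, the product running over the zeros \<open>x\<close>. On the unit circle
  \<open>\<bar>P\<bar> \<le> S\<close>, and Jensen's inequality turns this into \<open>\<bar>c\<bar> \<Prod>max 1 \<bar>x\<bar> \<le> S\<close>
  (\<open>prod_max_roots_le_circle_bound\<close>): replacing each factor \<open>z - x\<close> with \<open>\<bar>x\<bar> < 1\<close> by
  \<open>1 - x\<^sup>* z\<close>, where \<open>x\<^sup>*\<close> is the conjugate of \<open>x\<close>, changes no modulus on the circle, but makes
  the value at the origin have modulus \<open>\<bar>c\<bar> \<Prod>max 1 \<bar>x\<bar>\<close>, so the maximum modulus principle
  applies.

  Since \<open>\<bar>a\<^sub>0\<bar> = \<bar>c\<bar> \<Prod>\<bar>x\<bar>\<close>, squaring and dividing by \<open>\<bar>a\<^sub>0\<bar> \<bar>c\<bar>\<close> gives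
  \<open>\<Prod>(max 1 \<bar>x\<bar>)\<^sup>2 / \<bar>x\<bar> \<le> S\<^sup>2 / (\<bar>a\<^sub>0\<bar> \<bar>c\<bar>)\<close>. The right side is \<open>exp (2 L)\<close>. On the left
  the factor belonging to \<open>x\<close> is the larger of \<open>\<bar>x\<bar>\<close> and \<open>1 / \<bar>x\<bar>\<close>: it is at least \<open>1\<close>,
  and off the annulus it exceeds \<open>1 / (1 - \<rho>) \<ge> exp \<rho>\<close>
  (\<open>off_annulus_count_le\<close>). Taking logarithms yields \<open>\<rho> (N - \<nu>) \<le> 2 L\<close>.
\<close>

lemma norm_prod_mset: "norm (\<Prod>x\<in>#M. f x :: complex) = (\<Prod>x\<in>#M. norm (f x))"
  by (induction M) (simp_all add: norm_mult)

lemma prod_mset_pos: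
  fixes f :: "'a \<Rightarrow> real"
  assumes "\<And>x. x \<in># M \<Longrightarrow> 0 < f x"
  shows "0 < (\<Prod>x\<in>#M. f x)"
  using assms by (induction M) auto

lemma norm_reflected_factor:
  fixes z w :: complex
  assumes "norm z = 1"
  shows "norm (1 - cnj w * z) = norm (z - w)"
proof -
  have "z * cnj z = 1"
    using assms by (simp flip: complex_norm_square)
  then have "1 - cnj w * z = z * cnj (z - w)"
    by (simp add: algebra_simps)
  then show ?thesis
    using assms by (simp only: norm_mult complex_mod_cnj mult_1)
qed

text \<open>
  Jensen's inequality for polynomials: the Mahler measure is at most the maximum on the unit
  circle. All zeros inside the disc are reflected out of it before the value at the origin is
  compared with the boundary values.
\<close>
lemma prod_max_roots_le_circle_bound:
  fixes c :: complex and M :: "complex multiset"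
  assumes bound: "\<And>z. norm z = 1 \<Longrightarrow> norm (c * (\<Prod>x\<in>#M. z - x)) \<le> B"
  shows "norm c * (\<Prod>x\<in>#M. max 1 (norm x)) \<le> B"
proof -
  define h where "h x z = (if norm x < 1 then 1 - cnj x * z else z - x)" for x z :: complex
  define Q where "Q z = c * (\<Prod>x\<in>#M. h x z)" for z
  have h_holo: "h x holomorphic_on UNIV" for x
    unfolding h_def by (cases "norm x < 1") (auto intro!: holomorphic_intros)
  have "(\<lambda>z. \<Prod>x\<in>#M. h x z) holomorphic_on UNIV"
    by (induction M) (auto intro!: holomorphic_intros h_holo)
  then have Q_holo: "Q holomorphic_on UNIV"
    unfolding Q_def by (intro holomorphic_intros)
  have Q_circle: "norm (Q z) \<le> B" if "norm z = 1" for z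
  proof -
    have "norm (h x z) = norm (z - x)" for x
      using norm_reflected_factor[OF that] by (simp add: h_def)
    then have "norm (Q z) = norm (c * (\<Prod>x\<in>#M. z - x))"
      by (simp add: Q_def norm_mult norm_prod_mset)
    then show ?thesis
      using bound[OF that] by simp
  qed
  have "norm (h x 0) = max 1 (norm x)" for x
    by (simp add: h_def)
  then have "norm c * (\<Prod>x\<in>#M. max 1 (norm x)) = norm (Q 0)"
    by (simp add: Q_def norm_mult norm_prod_mset)
  also have "norm (Q 0) \<le> B"
  proof (rule maximum_modulus_frontier[of Q "cball 0 1"])
    show "Q holomorphic_on interior (cball 0 1)"
      using Q_holo by (rule holomorphic_on_subset) simp
    show "continuous_on (closure (cball 0 1)) Q"
      using Q_holo by (auto intro: holomorphic_on_imp_continuous_on holomorphic_on_subset)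
    show "norm (Q z) \<le> B" if "z \<in> frontier (cball 0 1)" for z
      using that by (intro Q_circle) (simp add: frontier_cball)
  qed auto
  finally show ?thesis .
qed

lemma norm_poly_circle_le:
  fixes p :: "complex poly"
  assumes "norm z = 1"
  shows "norm (poly p z) \<le> (\<Sum>k\<le>degree p. norm (coeff p k))"
proof -
  have "norm (poly p z) \<le> (\<Sum>k\<le>degree p. norm (coeff p k * z ^ k))"
    unfolding poly_altdef by (rule norm_sum)
  also have "\<dots> = (\<Sum>k\<le>degree p. norm (coeff p k))"
    using assms by (simp add: norm_mult norm_power)
  finally show ?thesis .
qed

text \<open>
  The summand \<open>2 ln (max 1 \<bar>x\<bar>) - ln \<bar>x\<bar>\<close> is \<open>\<bar>ln \<bar>x\<bar>\<bar>\<close>. Off the annulus this exceeds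
  \<open>- ln (1 - \<rho>)\<close>, and \<open>- ln (1 - \<rho>) \<ge> \<rho>\<close>.
\<close>
lemma off_annulus_le_ln_norm:
  fixes x :: complex
  assumes "x \<noteq> 0" "0 < \<rho>" "\<rho> < 1"
  shows "(if 1 - \<rho> \<le> norm x \<and> norm x \<le> 1 / (1 - \<rho>) then 0 else \<rho>)
           \<le> 2 * ln (max 1 (norm x)) - ln (norm x)"
proof -
  have abs_ln: "2 * ln (max 1 (norm x)) - ln (norm x) = \<bar>ln (norm x)\<bar>"
    using assms by (cases "norm x \<le> 1") (auto simp: max_def)
  have ln_le: "ln (1 - \<rho>) \<le> - \<rho>"
    using ln_le_minus_one[of "1 - \<rho>"] assms by simp
  have "\<rho> \<le> \<bar>ln (norm x)\<bar>" if "norm x < 1 - \<rho>"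
  proof -
    have "ln (norm x) \<le> ln (1 - \<rho>)"
      using that assms by simp
    then show ?thesis
      using ln_le by linarith
  qed
  moreover have "\<rho> \<le> \<bar>ln (norm x)\<bar>" if "norm x > 1 / (1 - \<rho>)"
  proof -
    have "ln (1 / (1 - \<rho>)) \<le> ln (norm x)"
      using that assms by (intro ln_mono) auto
    then show ?thesis
      using ln_le assms by (simp add: ln_div)
  qed
  ultimately show ?thesis
    unfolding abs_ln by auto
qed

lemma off_annulus_count_le:
  fixes M :: "complex multiset"
  assumes "0 \<notin># M" "0 < \<rho>" "\<rho> < 1"
  shows "\<rho> * (real (size M) - real (size {#x \<in># M. 1 - \<rho> \<le> norm x \<and> norm x \<le> 1 / (1 - \<rho>)#}))
           \<le> 2 * ln (\<Prod>x\<in>#M. max 1 (norm x)) - ln (\<Prod>x\<in>#M. norm x)"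
  using assms(1)
proof (induction M)
  case empty
  show ?case by simp
next
  case (add x M)
  have x: "x \<noteq> 0" and M: "0 \<notin># M"
    using add.prems by auto
  have "0 < (\<Prod>x\<in>#M. max 1 (norm x))" "0 < (\<Prod>x\<in>#M. norm x)"
    using M by (auto intro!: prod_mset_pos)
  then have "ln (\<Prod>x\<in>#add_mset x M. max 1 (norm x)) = ln (max 1 (norm x)) + ln (\<Prod>x\<in>#M. max 1 (norm x))"
    and "ln (\<Prod>x\<in>#add_mset x M. norm x) = ln (norm x) + ln (\<Prod>x\<in>#M. norm x)"
    using x by (simp_all add: ln_mult_pos del: prod_mset_zero_iff)
  then show ?case
    using add.IH[OF M] off_annulus_le_ln_norm[OF x assms(2,3)]
    by (cases "1 - \<rho> \<le> norm x \<and> norm x \<le> 1 / (1 - \<rho>)") (auto simp: distrib_left right_diff_distrib)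
qed

theorem theorem3:
  fixes N :: nat and a :: "nat \<Rightarrow> complex" and P :: "complex poly" and \<rho> :: real
  assumes "N \<ge> 1"
    and "a 0 * a N \<noteq> 0"
    and "P = (\<Sum>k\<le>N. monom (a k) k)"
    and "0 < \<rho>" and "\<rho> < 1"
  shows "1 - 1 / real N * real (nu P \<rho>) \<le> 2 / (real N * \<rho>) * L N P"
proof -
  have coeff: "coeff P k = (if k \<le> N then a k else 0)" for k
    by (simp add: assms(3) coeff_sum)
  have deg: "degree P = N"
    using assms(2) by (intro antisym degree_le le_degree) (auto simp: coeff)
  define S where "S = (\<Sum>k\<le>N. norm (coeff P k))"
  define T where "T = (\<Prod>x\<in>#proots P. max 1 (norm x))"
  define R where "R = (\<Prod>x\<in>#proots P. norm x)"
  define c where "c = coeff P N"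
  have c: "c \<noteq> 0" and a0: "coeff P 0 \<noteq> 0"
    using assms(2) by (auto simp: c_def coeff)
  have factor: "poly P z = c * (\<Prod>x\<in>#proots P. z - x)" for z
  proof -
    have "poly (\<Prod>x\<in>#M. [:-x, 1:]) z = (\<Prod>x\<in>#M. z - x)" for M
      by (induction M) (simp_all add: algebra_simps)
    then show ?thesis
      by (metis complex_poly_decompose_multiset poly_smult c_def deg)
  qed
  have zero: "0 \<notin># proots P"
  proof -
    have "P \<noteq> 0"
      using a0 by auto
    then show ?thesis
      using a0 by (simp add: poly_0_coeff_0)
  qed
  have T_pos: "0 < T"
    unfolding T_def by (intro prod_mset_pos) simp
  have R_pos: "0 < R"
    unfolding R_def using zero by (intro prod_mset_pos) auto

  have "norm c * T \<le> S"
    unfolding T_def S_def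
    by (rule prod_max_roots_le_circle_bound) (use norm_poly_circle_le[of _ P] in \<open>simp add: factor deg\<close>)
  then have "ln (norm c * T) \<le> ln S"
    using c T_pos by (intro ln_mono) auto
  then have jensen: "ln (norm c) + ln T \<le> ln S"
    using c T_pos by (simp add: ln_mult)

  have "norm (coeff P 0) = norm c * R"
    using factor[of 0] by (simp add: R_def poly_0_coeff_0 norm_mult norm_prod_mset)
  then have vieta: "ln (norm (coeff P 0)) = ln (norm c) + ln R"
    using c R_pos by (simp add: ln_mult)

  have "\<rho> * (real N - real (nu P \<rho>)) \<le> 2 * ln T - ln R"
    using off_annulus_count_le[OF zero assms(4,5)]
    by (simp add: nu_def T_def R_def size_proots_complex deg)
  also have "\<dots> \<le> 2 * L N P"
  proof -
    have "2 * L N P = 2 * ln S - ln (norm (coeff P 0)) - ln (norm c)"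
      by (simp add: L_def S_def c_def algebra_simps)
    then show ?thesis
      using jensen vieta by linarith
  qed
  finally have "\<rho> * (real N - real (nu P \<rho>)) / (real N * \<rho>) \<le> 2 * L N P / (real N * \<rho>)"
    using assms(4) by (intro divide_right_mono) auto
  moreover have "\<rho> * (real N - real (nu P \<rho>)) / (real N * \<rho>) = 1 - 1 / real N * real (nu P \<rho>)"
    using assms(1,4) by (simp add: diff_divide_distrib)
  ultimately show ?thesis
    by simp
qed

end
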